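(* Let $G$ be an uncountable Polish group and let $A\subseteq G$ be a universally measurable set such that $A^{-1}A=\{a^{-1}b: a,b\in A\}$ is meager in $G$. Then the set \[ T_l(A)=\{\mu\in P(G): \mu(gA)=0 \text{ for all } g\in G\} \] is co-meager in $P(G)$. Consequently, if $A\subseteq G$ is analytic and not generically left Haar-null (in particular, if $A$ is not left Haar-null), then $A^{-1}A$ is non-meager.
   Context: For a Polish space $X$, $P(X)$ denotes the space of all Borel probability measures on $X$ with the weak* topology (a Polish space). For a Polish group $G$ and a universally measurable set $A\subseteq G$: $A$ is called left Haar-null if there exists $\mu\in P(G)$ with $\mu(gA)=0$ for all $g\in G$; $A$ is called generically left Haar-null if the set $T_l(A)=\{\mu\in P(G): \mu(gA)=0 \text{ for all } g\in G\}$ is co-meager in $P(G)$. A subset of a Polish space is analytic if it is the image of $\mathbb{N}^{\mathbb{N}}$ under a continuous map. *)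

theory Defs
  imports "HOL-Analysis.Analysis" "HOL-Probability.Probability"
begin

definition nowhere_dense_in :: "'a topology \<Rightarrow> 'a set \<Rightarrow> bool" where
  "nowhere_dense_in X S \<longleftrightarrow> S \<subseteq> topspace X \<and> X interior_of (X closure_of S) = {}"

definition meager_in :: "'a topology \<Rightarrow> 'a set \<Rightarrow> bool" where
  "meager_in X S \<longleftrightarrow> S \<subseteq> topspace X \<and>
     (\<exists>F. countable F \<and> (\<forall>T\<in>F. nowhere_dense_in X T) \<and> S \<subseteq> \<Union>F)"

definition comeager_in :: "'a topology \<Rightarrow> 'a set \<Rightarrow> bool" where
  "comeager_in X S \<longleftrightarrow> S \<subseteq> topspace X \<and> meager_in X (topspace X - S)"

definition prob_measures :: "'a::topological_space measure set" where
  "prob_measures = {\<mu>. prob_space \<mu> \<and> sets \<mu> = sets (borel :: 'a measure)}"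

definition weak_star_topology :: "'a::topological_space measure topology" where
  "weak_star_topology = topology_generated_by
     {{\<mu> \<in> prob_measures. (\<integral>x. f x \<partial>\<mu>) \<in> U} | (f :: 'a \<Rightarrow> real) U.
        continuous_on UNIV f \<and> bounded (range f) \<and> open U}"

definition universally_measurable :: "'a::topological_space set \<Rightarrow> bool" where
  "universally_measurable A \<longleftrightarrow> (\<forall>\<mu>\<in>prob_measures. A \<in> sets (completion \<mu>))"

text \<open>Groups written additively (the group_add class is not commutative):
  gA is (\<lambda>a. g + a) ` A and A^{-1}A is {-a + b}.\<close>

definition T_l :: "'a::{topological_space, group_add} set \<Rightarrow> 'a measure set" where
  "T_l A = {\<mu> \<in> prob_measures. \<forall>g. measure (completion \<mu>) ((\<lambda>a. g + a) ` A) = 0}"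

definition left_Haar_null :: "'a::{topological_space, group_add} set \<Rightarrow> bool" where
  "left_Haar_null A \<longleftrightarrow> universally_measurable A \<and>
     (\<exists>\<mu>\<in>prob_measures. \<forall>g. measure (completion \<mu>) ((\<lambda>a. g + a) ` A) = 0)"

definition generically_left_Haar_null :: "'a::{topological_space, group_add} set \<Rightarrow> bool" where
  "generically_left_Haar_null A \<longleftrightarrow> universally_measurable A \<and>
     comeager_in weak_star_topology (T_l A)"

definition inv_prod :: "'a::group_add set \<Rightarrow> 'a set" where
  "inv_prod A = {- a + b | a b. a \<in> A \<and> b \<in> A}"

definition analytic :: "'a::topological_space set \<Rightarrow> bool" where
  "analytic A \<longleftrightarrow> (\<exists>f :: (nat \<Rightarrow> nat) \<Rightarrow> 'a. continuous_on UNIV f \<and> range f = A)"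

end

theory Submission
  imports Defs
begin

text \<open>
  Cover \<open>A\<^sup>-\<^sup>1A\<close> by an increasing sequence of closed nowhere dense sets \<open>F\<^sub>k\<close> containing the identity;
  this is possible since an uncountable separable group is not discrete. Call \<open>\<mu>\<close> dispersed
  at stage \<open>k\<close> if some finite family of open sets has no quotient \<open>v\<^sup>-\<^sup>1w\<close> of points of two
  different members in \<open>F\<^sub>k\<close>, and omitting any one member still leaves measure more than
  \<open>1 - 2\<^sup>-\<^sup>k\<close>. These measures form an open set, which is dense because any measure is approximated
  by finitely supported measures with small atoms and supports in general position.
  If \<open>\<mu>\<close> is dispersed at every stage, then by Borel-Cantelli almost every point lies in the
  \<open>k\<close>-th family for all large \<open>k\<close>. Two such points of \<open>gA\<close> have their quotient in \<open>F\<^sub>k\<close> for all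
  large \<open>k\<close>, hence lie in the same member, of measure less than \<open>2\<^sup>-\<^sup>k\<close>; so \<open>\<mu>(gA) = 0\<close>.

  For the last claim a measure in \<open>T\<^sub>l(A)\<close> is exhibited directly instead of using that \<open>P(G)\<close> is
  a Baire space: a Cantor scheme yields a Borel map from \<open>[0,1)\<close> to \<open>G\<close> under which the preimage
  of every \<open>gA\<close> has at most one point, and the image of Lebesgue measure is as wanted.
\<close>

section \<open>Analytic sets are universally measurable\<close>

lemma compact_bounded_sequences: "compact {x :: nat \<Rightarrow> nat. \<forall>i. x i \<le> n i}"
proof -
  have "compactin (product_topology (\<lambda>i. euclidean) UNIV) (PiE UNIV (\<lambda>i. {..n i}))"
    by (subst compactin_PiE) (auto intro: finite_imp_compact)
  moreover have "PiE UNIV (\<lambda>i. {..n i}) = {x. \<forall>i. x i \<le> n i}"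
    by (auto simp: PiE_def Pi_def extensional_def)
  ultimately show ?thesis
    by (simp add: euclidean_product_topology compactin_euclidean_iff)
qed

lemma tendsto_fun_iff:
  fixes x :: "'b \<Rightarrow> 'i \<Rightarrow> 'c::topological_space"
  shows "(x \<longlongrightarrow> l) G \<longleftrightarrow> (\<forall>i. ((\<lambda>k. x k i) \<longlongrightarrow> l i) G)"
  using limitin_componentwise[of "\<lambda>_. euclidean" UNIV x l G]
  by (simp add: euclidean_product_topology)

text \<open>Compactness argument: if every finite stage had a point outside \<open>U\<close>, a
  subsequence of these points would converge to a point of the compact set, which lies in
  \<open>U\<close>. It lets finitely many coordinate bounds stand in for all of them.\<close>

lemma open_superset_bounded_sequences:
  fixes n :: "nat \<Rightarrow> nat"
  assumes "open U" and sub: "{x. \<forall>i. x i \<le> n i} \<subseteq> U"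
  shows "\<exists>k. {x. \<forall>i<k. x i \<le> n i} \<subseteq> U"
proof (rule ccontr)
  assume "\<not> ?thesis"
  then have "\<exists>x. (\<forall>i<k. x i \<le> n i) \<and> x \<notin> U" for k by blast
  then obtain x where x: "\<And>k i. i < k \<Longrightarrow> x k i \<le> n i" "\<And>k. x k \<notin> U" by metis
  \<comment> \<open>Truncation at \<open>n\<close> moves \<open>x k\<close> into the compact set and
    leaves its coordinates below \<open>k\<close> unchanged, so both sequences have the same
    coordinatewise limits.\<close>
  define y where "y k i = min (x k i) (n i)" for k i
  have "\<forall>k. y k \<in> {x. \<forall>i. x i \<le> n i}" by (auto simp: y_def)
  then obtain l r where l: "l \<in> {x. \<forall>i. x i \<le> n i}" and r: "strict_mono r" and "(y \<circ> r) \<longlonglongrightarrow> l"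
    using compact_imp_seq_compact[OF compact_bounded_sequences[of n]] by (elim seq_compactE)
  then have yl: "((\<lambda>k. y (r k) i) \<longlongrightarrow> l i) sequentially" for i
    by (simp add: tendsto_fun_iff o_def)
  have "((\<lambda>k. x (r k) i) \<longlongrightarrow> l i) sequentially" for i
  proof -
    have "\<forall>\<^sub>F k in sequentially. y (r k) i = x (r k) i"
      using eventually_gt_at_top[of i]
    proof eventually_elim
      case (elim k)
      then have "i < r k" using seq_suble[OF r, of k] by simp
      then show ?case using x(1) by (simp add: y_def min_absorb1)
    qed
    then show ?thesis using yl tendsto_cong by metis
  qed
  then have "(x \<circ> r) \<longlonglongrightarrow> l"
    by (simp add: tendsto_fun_iff o_def)
  moreover have "l \<in> U" using l sub by auto
  ultimately have "\<forall>\<^sub>F k in sequentially. (x \<circ> r) k \<in> U"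
    using \<open>open U\<close> topological_tendstoD by blast
  then show False using x(2) by (auto dest: eventually_happens)
qed

text \<open>Choquet's capacitability argument. The coordinates are bounded one at a time, each bound
  large enough to keep the outer measure of the image above \<open>c\<close>; the sequences obeying
  all bounds form a compact set, and \<open>K\<close> is its image.\<close>

lemma outer_measure_analytic_compact:
  fixes \<mu> :: "'a::polish_space measure"
  assumes \<mu>: "finite_measure \<mu>" "sets \<mu> = sets borel"
    and f: "continuous_on UNIV (f :: (nat \<Rightarrow> nat) \<Rightarrow> 'a)"
    and c: "c < outer_measure_of \<mu> (range f)"
  shows "\<exists>K. compact K \<and> K \<subseteq> range f \<and> c \<le> emeasure \<mu> K"
proof -
  interpret finite_measure \<mu> by fact
  have sp: "space \<mu> = UNIV" using \<mu>(2) sets_eq_imp_space_eq by fastforce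
  define C where "C s k = {x :: nat \<Rightarrow> nat. \<forall>i<k. x i \<le> s i}" for s :: "nat \<Rightarrow> nat" and k :: nat
  have "\<exists>s. \<forall>k. c < outer_measure_of \<mu> (f ` C (s k) k) \<and> (\<forall>i<k. s (Suc k) i = s k i)"
  proof (rule dependent_nat_choice)
    show "\<exists>s. c < outer_measure_of \<mu> (f ` C s 0)" using c by (simp add: C_def)
  next
    fix s :: "nat \<Rightarrow> nat" and k
    assume *: "c < outer_measure_of \<mu> (f ` C s k)"
    \<comment> \<open>Here \<open>m\<close> is the candidate bound for coordinate \<open>k\<close>.
      The sets \<open>D m\<close> increase and cover the current image, and outer measure is
      continuous along increasing sequences of arbitrary sets.\<close>
    define D where "D m = f ` C (s(k := m)) (Suc k)" for m
    have "incseq D"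
    proof (rule incseq_SucI)
      show "D m \<le> D (Suc m)" for m
        unfolding D_def C_def by (intro image_mono) (force simp: less_Suc_eq)
    qed
    have "f ` C s k \<subseteq> (\<Union>m. D m)"
    proof
      fix y assume "y \<in> f ` C s k"
      then obtain x where x: "x \<in> C s k" "y = f x" by auto
      then have "x \<in> C (s(k := x k)) (Suc k)" by (auto simp: C_def less_Suc_eq)
      then show "y \<in> (\<Union>m. D m)" using x by (auto simp: D_def)
    qed
    then have "c < outer_measure_of \<mu> (\<Union>m. D m)"
      using * outer_measure_of_mono less_le_trans by blast
    also have "\<dots> = (SUP m. outer_measure_of \<mu> (D m))"
      using \<open>incseq D\<close> by (simp add: SUP_outer_measure_of_incseq sp)
    finally obtain m where "c < outer_measure_of \<mu> (D m)" by (auto simp: less_SUP_iff)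
    then show "\<exists>s'. c < outer_measure_of \<mu> (f ` C s' (Suc k)) \<and> (\<forall>i<k. s' i = s i)"
      by (intro exI[of _ "s(k := m)"]) (auto simp: D_def)
  qed
  then obtain s where s: "\<And>k. c < outer_measure_of \<mu> (f ` C (s k) k)"
    and step: "\<And>k i. i < k \<Longrightarrow> s (Suc k) i = s k i" by metis
  define n where "n i = s (Suc i) i" for i
  have n: "i < k \<Longrightarrow> s k i = n i" for i k
  proof (induction k)
    case (Suc k)
    then show ?case by (cases "i = k") (auto simp: n_def step)
  qed simp
  define K where "K = f ` {x. \<forall>i. x i \<le> n i}"
  have "compact K" unfolding K_def
    by (intro compact_continuous_image compact_bounded_sequences continuous_on_subset[OF f]) auto
  then have "K \<in> sets borel" by (simp add: borel_compact)
  \<comment> \<open>Outer measure need not be continuous along the decreasing images of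
    \<open>C (s k) k\<close>. Outer regularity avoids this: every open superset of \<open>K\<close>
    already contains one of these images.\<close>
  have "emeasure \<mu> K = (INF U \<in> {U. K \<subseteq> U \<and> open U}. emeasure \<mu> U)"
    using \<mu>(2) \<open>K \<in> sets borel\<close> by (intro outer_regular) auto
  also have "\<dots> \<ge> c"
  proof (rule INF_greatest, safe)
    fix U assume U: "K \<subseteq> U" "open U"
    then have "open (f -` U)" using f by (simp add: open_vimage)
    moreover have "{x. \<forall>i. x i \<le> n i} \<subseteq> f -` U" using U(1) by (auto simp: K_def)
    ultimately obtain k where "{x. \<forall>i<k. x i \<le> n i} \<subseteq> f -` U"
      using open_superset_bounded_sequences by blast
    then have "f ` C (s k) k \<subseteq> U" using n by (auto simp: C_def)
    then have "outer_measure_of \<mu> (f ` C (s k) k) \<le> outer_measure_of \<mu> U"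
      by (rule outer_measure_of_mono)
    moreover have "U \<in> sets \<mu>" using U \<mu>(2) by simp
    ultimately show "c \<le> emeasure \<mu> U" using s[of k] by (simp add: order.strict_implies_order less_le_trans)
  qed
  finally show ?thesis using \<open>compact K\<close> by (intro exI[of _ K]) (auto simp: K_def)
qed

text \<open>Compact subsets of \<open>A\<close> approximate the measure of its measurable hull
  \<open>E\<close>. Countably many of them have a union \<open>B\<close> with \<open>E - B\<close>
  null, so \<open>A\<close> is trapped between two measurable sets that differ by a null
  set.\<close>

lemma analytic_imp_universally_measurable:
  fixes A :: "'a::polish_space set"
  assumes "analytic A"
  shows "universally_measurable A"
  unfolding universally_measurable_def
proof
  fix \<mu> :: "'a measure" assume "\<mu> \<in> prob_measures"
  then have P: "prob_space \<mu>" and sets: "sets \<mu> = sets borel" by (auto simp: prob_measures_def)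
  interpret prob_space \<mu> by fact
  have sp: "space \<mu> = UNIV" using sets sets_eq_imp_space_eq by fastforce
  obtain f :: "(nat \<Rightarrow> nat) \<Rightarrow> 'a" where f: "continuous_on UNIV f" "range f = A"
    using assms by (auto simp: analytic_def)
  obtain E where E: "E \<in> sets \<mu>" "A \<subseteq> E" "outer_measure_of \<mu> A = emeasure \<mu> E"
    using outer_measure_of_attain[of A \<mu>] sp by auto
  define \<K> where "\<K> = {K. compact K \<and> K \<subseteq> A}"
  have sK: "K \<in> sets \<mu>" if "K \<in> \<K>" for K
    using that by (simp add: sets \<K>_def borel_compact)
  have "{} \<in> \<K>" by (simp add: \<K>_def)
  have le: "emeasure \<mu> E \<le> (SUP K\<in>\<K>. emeasure \<mu> K)"
  proof (rule dense_le)
    fix c assume "c < emeasure \<mu> E"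
    then obtain K where "K \<in> \<K>" "c \<le> emeasure \<mu> K"
      using outer_measure_analytic_compact[OF finite_measure_axioms sets f(1)] E(3) f(2)
      by (auto simp: \<K>_def)
    then show "c \<le> (SUP K\<in>\<K>. emeasure \<mu> K)" by (meson SUP_upper order_trans)
  qed
  have "emeasure \<mu> ` \<K> \<noteq> {}" using \<open>{} \<in> \<K>\<close> by auto
  from ennreal_Sup_countable_SUP[OF this] obtain g :: "nat \<Rightarrow> ennreal"
    where g: "range g \<subseteq> emeasure \<mu> ` \<K>" "(SUP K\<in>\<K>. emeasure \<mu> K) = (SUP i. g i)" by auto
  then have "\<exists>K\<in>\<K>. g i = emeasure \<mu> K" for i by (auto simp: image_subset_iff)
  then obtain K where K: "\<And>i. K i \<in> \<K>" "\<And>i. g i = emeasure \<mu> (K i)" by metis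
  define B where "B = (\<Union>i. K i)"
  have B: "B \<in> sets \<mu>" "B \<subseteq> A" using K(1) sK by (auto simp: B_def \<K>_def)
  have "(SUP i. g i) \<le> emeasure \<mu> B"
    using K sK B(1) by (auto simp: B_def intro!: SUP_least emeasure_mono)
  then have "emeasure \<mu> E \<le> emeasure \<mu> B" using le g(2) by simp
  then have "emeasure \<mu> (E - B) = 0"
    using emeasure_Diff[of \<mu> B E] B E by (simp add: diff_eq_0_iff_ennreal emeasure_eq_measure)
  then have "E - B \<in> null_sets \<mu>" using E B by auto
  then show "A \<in> sets (completion \<mu>)"
    using B E by (intro sets_completionI[of A B "A - B" "E - B"]) auto
qed

section \<open>Avoiding nowhere dense sets of differences\<close>

lemma not_open_singleton_zero:
  assumes "uncountable (UNIV :: 'a::{second_countable_topology, topological_group_add} set)"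
  shows "\<not> open {0 :: 'a}"
proof
  assume *: "open {0 :: 'a}"
  have "open {g}" for g :: 'a
  proof -
    have "open ((\<lambda>x. - g + x) -` {0})"
      by (intro open_vimage[OF *] continuous_intros)
    moreover have "(\<lambda>x. - g + x) -` {0} = {g}"
      by (auto simp: neg_eq_iff_add_eq_0[symmetric])
    ultimately show ?thesis by simp
  qed
  moreover obtain D :: "'a set" where "countable D" "\<And>X. open X \<Longrightarrow> X \<noteq> {} \<Longrightarrow> \<exists>d\<in>D. d \<in> X"
    by (rule countable_dense_setE) blast
  ultimately have "UNIV \<subseteq> D" by fastforce
  with \<open>countable D\<close> assms show False using countable_subset by blast
qed

text \<open>Pulling the interior back along \<open>k\<close>, the inverse of \<open>h\<close>, gives
  an open subset of \<open>F\<close>. It is used for translations, and for inversion followed by a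
  translation.\<close>

lemma interior_vimage_eq_empty:
  assumes "continuous_on UNIV k" "\<And>z. h (k z) = z" "\<And>y. k (h y) = y" "interior F = {}"
  shows "interior (h -` F) = {}"
proof -
  have "open (k -` interior (h -` F))" using assms(1) by (simp add: open_vimage)
  moreover have "k -` interior (h -` F) \<subseteq> F"
    using interior_subset[of "h -` F"] assms(2) by (metis subset_iff vimage_eq)
  ultimately have "k -` interior (h -` F) = {}" using assms(4) interior_maximal by blast
  then show ?thesis using assms(3) by (metis all_not_in_conv vimage_eq)
qed

text \<open>The points are chosen one after another. Each earlier point forbids only a closed set
  with empty interior, and a finite union of such sets cannot contain the nonempty open set from
  which the next point is taken.\<close>

lemma exists_points_differences_avoid:
  fixes F :: "'a::topological_group_add set"
  assumes "finite I" "closed F" "interior F = {}" "\<And>i. i \<in> I \<Longrightarrow> open (U i) \<and> U i \<noteq> {}"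
  shows "\<exists>q. (\<forall>i\<in>I. q i \<in> U i) \<and> (\<forall>i\<in>I. \<forall>j\<in>I. i \<noteq> j \<longrightarrow> - q i + q j \<notin> F)"
  using assms(1,4)
proof (induction I rule: finite_induct)
  case (insert a I)
  then obtain q where q: "\<forall>i\<in>I. q i \<in> U i" "\<forall>i\<in>I. \<forall>j\<in>I. i \<noteq> j \<longrightarrow> - q i + q j \<notin> F" by auto
  \<comment> \<open>Both orders of the quotient must be forbidden, since \<open>F\<close> is not
    assumed symmetric.\<close>
  define D where "D p = (\<lambda>y. - p + y) -` F \<union> (\<lambda>y. - y + p) -` F" for p
  have clD: "closed (D p)" for p
    unfolding D_def by (intro closed_Un closed_vimage[OF \<open>closed F\<close>] continuous_intros)
  have intD: "interior (D p) = {}" for p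
  proof -
    have "interior ((\<lambda>y. - p + y) -` F) = {}"
      by (rule interior_vimage_eq_empty[where k = "\<lambda>z. p + z"])
        (auto intro!: continuous_intros simp: assms add.assoc[symmetric])
    moreover have "interior ((\<lambda>y. - y + p) -` F) = {}"
      by (rule interior_vimage_eq_empty[where k = "\<lambda>z. p + - z"])
        (auto intro!: continuous_intros simp: assms minus_add add.assoc[symmetric])
    moreover have "closed ((\<lambda>y. - p + y) -` F)"
      by (intro closed_vimage[OF \<open>closed F\<close>] continuous_intros)
    ultimately show ?thesis
      unfolding D_def by (simp add: interior_closed_Un_empty_interior)
  qed
  have "closed (\<Union>i\<in>I. D (q i)) \<and> interior (\<Union>i\<in>I. D (q i)) = {}"
    using \<open>finite I\<close>
    by (induction I rule: finite_induct)
      (auto simp: clD intD interior_closed_Un_empty_interior closed_Un)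
  then have "\<not> U a \<subseteq> (\<Union>i\<in>I. D (q i))"
    using insert.prems[of a] interior_maximal by blast
  then obtain y where y: "y \<in> U a" "y \<notin> (\<Union>i\<in>I. D (q i))" by blast
  show ?case
    using q y insert.hyps by (intro exI[of _ "q(a := y)"]) (auto simp: D_def)
qed auto

text \<open>Continuity of the quotient map and openness of \<open>- F\<close>. The form with
  \<open>at_right 0\<close> lets the conditions for finitely many pairs hold at one common
  radius.\<close>

lemma eventually_two_balls_differences_avoid:
  fixes F :: "'a::{metric_space, topological_group_add} set"
  assumes "closed F" "- p + q \<notin> F"
  shows "\<forall>\<^sub>F r in at_right 0. \<forall>v\<in>ball p r. \<forall>w\<in>ball q r. - v + w \<notin> F"
proof -
  have "open ((\<lambda>z::'a \<times> 'a. - fst z + snd z) -` (- F))"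
    using assms(1) by (intro open_vimage continuous_intros) auto
  moreover have "(p, q) \<in> (\<lambda>z. - fst z + snd z) -` (- F)" using assms(2) by simp
  ultimately obtain A B where AB: "open A" "open B" "(p, q) \<in> A \<times> B"
    "A \<times> B \<subseteq> (\<lambda>z. - fst z + snd z) -` (- F)"
    by (rule open_prod_elim)
  then obtain a b where ab: "a > 0" "ball p a \<subseteq> A" "b > 0" "ball q b \<subseteq> B"
    by (metis mem_Sigma_iff open_contains_ball)
  have "\<forall>\<^sub>F r in at_right 0. r < min a b"
    using ab by (intro order_tendstoD(2)[OF tendsto_ident_at]) auto
  then show ?thesis
  proof eventually_elim
    case (elim r)
    then have "ball p r \<subseteq> A" "ball q r \<subseteq> B" using ab by auto
    then show ?case using AB(4) by fastforce
  qed
qed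

lemma eventually_balls_differences_avoid:
  fixes F :: "'a::{metric_space, topological_group_add} set"
  assumes "finite I" "closed F" "\<And>i j. i \<in> I \<Longrightarrow> j \<in> I \<Longrightarrow> i \<noteq> j \<Longrightarrow> - q i + q j \<notin> F"
  shows "\<forall>\<^sub>F r in at_right 0. \<forall>i\<in>I. \<forall>j\<in>I. i \<noteq> j \<longrightarrow>
           (\<forall>v\<in>ball (q i) r. \<forall>w\<in>ball (q j) r. - v + w \<notin> F)"
proof (intro eventually_ball_finite \<open>finite I\<close> ballI)
  fix i j assume "i \<in> I" "j \<in> I"
  then show "\<forall>\<^sub>F r in at_right 0. i \<noteq> j \<longrightarrow> (\<forall>v\<in>ball (q i) r. \<forall>w\<in>ball (q j) r. - v + w \<notin> F)"
    using eventually_two_balls_differences_avoid[OF assms(2) assms(3)] by (cases "i = j") auto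
qed

text \<open>Finite unions of closed sets with empty interior are again such sets, so partial unions
  of the closures make the cover increasing. Adding \<open>0\<close> to every member makes sets
  separated by \<open>F n\<close> disjoint.\<close>

lemma meager_exhaustion:
  fixes S :: "'a::{t1_space, zero} set"
  assumes "meager_in euclidean S" "\<not> open {0 :: 'a}"
  obtains F :: "nat \<Rightarrow> 'a set"
  where "incseq F" "\<And>n. closed (F n)" "\<And>n. interior (F n) = {}" "\<And>n. 0 \<in> F n" "S \<subseteq> (\<Union>n. F n)"
proof -
  obtain \<F> where \<F>: "countable \<F>" "\<And>T. T \<in> \<F> \<Longrightarrow> interior (closure T) = {}" "S \<subseteq> \<Union>\<F>"
    using assms(1) unfolding meager_in_def nowhere_dense_in_def
    by auto
  define T where "T = from_nat_into (insert {} \<F>)"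
  have "range T = insert {} \<F>" unfolding T_def using \<F>(1) by (intro range_from_nat_into) auto
  then have T: "interior (closure (T n)) = {}" for n
    using \<F>(2)[of "T n"] by (cases "T n = {}") auto
  have "S \<subseteq> (\<Union>n. T n)"
    using \<F>(3) \<open>range T = _\<close> by simp
  \<comment> \<open>The first set \<open>F 0\<close> is \<open>{0}\<close>; its interior is empty
    exactly because the group is not discrete.\<close>
  define F where "F n = insert 0 (\<Union>i<n. closure (T i))" for n
  have clF: "closed (F n) \<and> interior (F n) = {}" for n
  proof (induction n)
    case 0
    have "interior {0 :: 'a} \<noteq> {0}" using assms(2) by (metis open_interior)
    then show ?case using interior_subset[of "{0 :: 'a}"] by (auto simp: F_def)
  next
    case (Suc n)
    have "F (Suc n) = F n \<union> closure (T n)" by (auto simp: F_def lessThan_Suc)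
    then show ?case using Suc T[of n] by (simp add: interior_closed_Un_empty_interior closed_Un)
  qed
  show ?thesis
  proof (rule that[of F])
    show "incseq F" by (rule incseq_SucI) (auto simp: F_def)
    have "T n \<subseteq> F (Suc n)" for n using closure_subset[of "T n"] by (auto simp: F_def)
    then have "(\<Union>n. T n) \<subseteq> (\<Union>n. F n)" by (intro UN_least) (rule SUP_upper2, auto)
    with \<open>S \<subseteq> (\<Union>n. T n)\<close> show "S \<subseteq> (\<Union>n. F n)" by (rule order_trans)
    show "closed (F n)" "interior (F n) = {}" for n using clF[of n] by auto
    show "0 \<in> F n" for n by (simp add: F_def)
  qed
qed

text \<open>Points in general position are thickened to balls of one common radius. This is the
  construction step both for the density of dispersed measures and for the Cantor scheme.\<close>

lemma exists_cballs_differences_avoid: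
  fixes F :: "'a::{metric_space, topological_group_add} set"
  assumes "finite I" "closed F" "interior F = {}" "\<And>i. i \<in> I \<Longrightarrow> open (U i) \<and> U i \<noteq> {}" "d > 0"
  obtains q r where "0 < r" "r < d" "\<And>i. i \<in> I \<Longrightarrow> cball (q i) r \<subseteq> U i"
    "\<And>i j v w. i \<in> I \<Longrightarrow> j \<in> I \<Longrightarrow> i \<noteq> j \<Longrightarrow> v \<in> cball (q i) r \<Longrightarrow> w \<in> cball (q j) r \<Longrightarrow> - v + w \<notin> F"
proof -
  have "\<exists>q. (\<forall>i\<in>I. q i \<in> U i) \<and> (\<forall>i\<in>I. \<forall>j\<in>I. i \<noteq> j \<longrightarrow> - q i + q j \<notin> F)"
    by (rule exists_points_differences_avoid) (use assms in auto)
  then obtain q where q: "\<And>i. i \<in> I \<Longrightarrow> q i \<in> U i"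
    "\<And>i j. i \<in> I \<Longrightarrow> j \<in> I \<Longrightarrow> i \<noteq> j \<Longrightarrow> - q i + q j \<notin> F" by auto
  have "\<forall>\<^sub>F r in at_right 0. \<forall>i\<in>I. ball (q i) r \<subseteq> U i"
  proof (intro eventually_ball_finite \<open>finite I\<close> ballI)
    fix i assume "i \<in> I"
    then obtain e where e: "e > 0" "ball (q i) e \<subseteq> U i"
      using q(1) assms(4) by (metis open_contains_ball)
    have "\<forall>\<^sub>F r in at_right 0. r < e"
      using e by (intro order_tendstoD(2)[OF tendsto_ident_at])
    then show "\<forall>\<^sub>F r in at_right 0. ball (q i) r \<subseteq> U i"
      by eventually_elim (use e in auto)
  qed
  moreover have "\<forall>\<^sub>F r in at_right 0. r < d"
    using assms(5) by (intro order_tendstoD(2)[OF tendsto_ident_at])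
  moreover have "\<forall>\<^sub>F r in at_right (0::real). 0 < r" by (rule eventually_at_right_less)
  moreover have "\<forall>\<^sub>F r in at_right 0. \<forall>i\<in>I. \<forall>j\<in>I. i \<noteq> j \<longrightarrow>
      (\<forall>v\<in>ball (q i) r. \<forall>w\<in>ball (q j) r. - v + w \<notin> F)"
    using assms(1,2) q(2) by (intro eventually_balls_differences_avoid)
  ultimately have "\<forall>\<^sub>F r in at_right 0. 0 < r \<and> r < d \<and> (\<forall>i\<in>I. ball (q i) r \<subseteq> U i) \<and>
    (\<forall>i\<in>I. \<forall>j\<in>I. i \<noteq> j \<longrightarrow> (\<forall>v\<in>ball (q i) r. \<forall>w\<in>ball (q j) r. - v + w \<notin> F))"
    by eventually_elim auto
  from eventually_happens'[OF trivial_limit_at_right_real this]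
  obtain r where r: "0 < r" "r < d" "\<forall>i\<in>I. ball (q i) r \<subseteq> U i"
    "\<forall>i\<in>I. \<forall>j\<in>I. i \<noteq> j \<longrightarrow> (\<forall>v\<in>ball (q i) r. \<forall>w\<in>ball (q j) r. - v + w \<notin> F)"
    by auto
  \<comment> \<open>Halving the radius passes from open balls to closed ones, which the Cantor
    scheme needs for its nested intersections.\<close>
  have sub: "cball (q i) (r/2) \<subseteq> ball (q i) r" for i using r(1) by auto
  show ?thesis
  proof (rule that[of "r/2" q])
    show "cball (q i) (r/2) \<subseteq> U i" if "i \<in> I" for i using sub[of i] r(3) that by blast
    show "- v + w \<notin> F"
      if "i \<in> I" "j \<in> I" "i \<noteq> j" "v \<in> cball (q i) (r/2)" "w \<in> cball (q j) (r/2)" for i j v w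
      using r(4) that subsetD[OF sub that(4)] subsetD[OF sub that(5)] by blast
  qed (use r(1,2) in auto)
qed

section \<open>The weak* topology\<close>

lemma prob_measuresD:
  assumes "\<mu> \<in> prob_measures"
  shows "prob_space \<mu>" "sets \<mu> = sets borel" "space \<mu> = UNIV"
  using assms sets_eq_imp_space_eq[of \<mu> borel] by (auto simp: prob_measures_def)

lemma measure_prob_measures_UNIV: "\<mu> \<in> prob_measures \<Longrightarrow> measure \<mu> UNIV = 1"
  using prob_space.prob_space[OF prob_measuresD(1), of \<mu>] prob_measuresD(3)[of \<mu>] by simp

lemma integrable_bounded_continuous:
  fixes f :: "'a::topological_space \<Rightarrow> real"
  assumes "\<mu> \<in> prob_measures" "continuous_on UNIV f" "bounded (range f)"
  shows "integrable \<mu> f"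
proof -
  interpret prob_space \<mu> by (rule prob_measuresD(1)[OF assms(1)])
  obtain B where "\<And>x. norm (f x) \<le> B" using assms(3) by (auto simp: bounded_iff)
  moreover have "f \<in> borel_measurable \<mu>"
    using borel_measurable_continuous_onI[OF assms(2)]
      measurable_cong_sets[OF prob_measuresD(2)[OF assms(1)] refl] by blast
  ultimately show ?thesis by (intro integrable_const_bound[of f B]) auto
qed

lemma topspace_weak_star [simp]: "topspace weak_star_topology = prob_measures"
proof -
  have "{\<mu> \<in> prob_measures. (\<integral>x. 0 \<partial>\<mu>) \<in> (UNIV :: real set)} = (prob_measures :: 'a measure set)"
    by simp
  then have "(prob_measures :: 'a measure set) \<in> {{\<mu> \<in> prob_measures. (\<integral>x. f x \<partial>\<mu>) \<in> U} | (f :: 'a \<Rightarrow> real) U.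
        continuous_on UNIV f \<and> bounded (range f) \<and> open U}"
    by (intro CollectI exI[of _ "\<lambda>_. 0"] exI[of _ UNIV]) auto
  then show ?thesis
    unfolding weak_star_topology_def topology_generated_by_topspace by blast
qed

lemma openin_weak_star_integral:
  fixes f :: "'a::topological_space \<Rightarrow> real"
  assumes "continuous_on UNIV f" "bounded (range f)" "open U"
  shows "openin weak_star_topology {\<mu> \<in> prob_measures. (\<integral>x. f x \<partial>\<mu>) \<in> U}"
  unfolding weak_star_topology_def
  by (rule topology_generated_by_Basis) (use assms in blast)

text \<open>The portmanteau inequality for open sets: the indicator of \<open>V\<close> is a
  pointwise limit from below of bounded continuous functions, so the condition is a union over
  \<open>n\<close> of subbasic open conditions.\<close>

lemma openin_weak_star_measure_open:
  fixes V :: "'a::metric_space set"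
  assumes "open V"
  shows "openin weak_star_topology {\<mu> \<in> prob_measures. c < measure \<mu> V}"
\<comment> \<open>The whole space is treated apart, because \<open>infdist\<close> to the empty
  complement is \<open>0\<close> by convention and the approximating functions would vanish.\<close>
proof (cases "V = UNIV")
  case True
  have "{\<mu> \<in> prob_measures. c < measure \<mu> V} = (if c < 1 then prob_measures else {})"
    using True by (auto simp: measure_prob_measures_UNIV)
  then show ?thesis using openin_topspace[of "weak_star_topology :: 'a measure topology"] by simp
next
  case False
  define f where "f n x = min 1 (real n * infdist x (- V))" for n :: nat and x :: 'a
  have cont: "continuous_on UNIV (f n)" for n
    unfolding f_def by (intro continuous_intros)
  have bdd: "bounded (range (f n))" for n
    by (rule boundedI[of _ 1]) (auto simp: f_def infdist_nonneg)
  have f01: "0 \<le> f n x" "f n x \<le> indicator V x" for n x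
    using False by (auto simp: f_def infdist_nonneg indicator_def)
  have lim: "(\<lambda>n. f n x) \<longlonglongrightarrow> indicator V x" for x
  proof (cases "x \<in> V")
    case True
    then have "infdist x (- V) > 0"
      using in_closed_iff_infdist_zero[of "- V" x] False assms infdist_nonneg[of x "- V"] by force
    then obtain N where N: "1 < real N * infdist x (- V)"
      using reals_Archimedean3 by blast
    have "\<forall>\<^sub>F n in sequentially. f n x = 1"
      using eventually_ge_at_top[of N]
    proof eventually_elim
      case (elim n)
      then have "real N * infdist x (- V) \<le> real n * infdist x (- V)"
        using infdist_nonneg by (intro mult_right_mono) auto
      then show ?case using N by (simp add: f_def)
    qed
    then show ?thesis using True by (simp add: tendsto_eventually)
  next
    case False
    then show ?thesis by (simp add: f_def)
  qed
  have eq: "{\<mu> \<in> prob_measures. c < measure \<mu> V} = (\<Union>n. {\<mu> \<in> prob_measures. (\<integral>x. f n x \<partial>\<mu>) \<in> {c<..}})"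
    (is "?L = ?R")
  proof (rule set_eqI)
    fix \<mu> :: "'a measure"
    show "\<mu> \<in> ?L \<longleftrightarrow> \<mu> \<in> ?R"
    proof (cases "\<mu> \<in> prob_measures")
      case True
      interpret prob_space \<mu> by (rule prob_measuresD(1)[OF True])
      have V: "V \<in> sets \<mu>" using assms prob_measuresD(2)[OF True] by simp
      have int: "integrable \<mu> (f n)" for n
        by (rule integrable_bounded_continuous[OF True cont bdd])
      have mV: "(\<integral>x. indicator V x \<partial>\<mu>) = measure \<mu> V"
        using V by (simp add: prob_measuresD(3)[OF True])
      have le: "(\<integral>x. f n x \<partial>\<mu>) \<le> measure \<mu> V" for n
        unfolding mV[symmetric] using int V f01 by (intro integral_mono) (auto simp: emeasure_eq_measure)
      have "(\<lambda>n. \<integral>x. f n x \<partial>\<mu>) \<longlonglongrightarrow> (\<integral>x. indicator V x \<partial>\<mu>)"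
      proof (rule integral_dominated_convergence[where w = "\<lambda>_. 1"])
        show "AE x in \<mu>. norm (f n x) \<le> 1" for n
          using f01 by (intro AE_I2) (auto simp: f_def infdist_nonneg)
      qed (use V lim int in \<open>auto intro: borel_measurable_integrable\<close>)
      then have lim': "(\<lambda>n. \<integral>x. f n x \<partial>\<mu>) \<longlonglongrightarrow> measure \<mu> V" by (simp only: mV)
      have "c < measure \<mu> V \<longleftrightarrow> (\<exists>n. c < (\<integral>x. f n x \<partial>\<mu>))"
      proof
        assume "c < measure \<mu> V"
        from order_tendstoD(1)[OF lim' this] show "\<exists>n. c < (\<integral>x. f n x \<partial>\<mu>)"
          by (auto dest: eventually_happens)
      qed (use le less_le_trans in blast)
      then show ?thesis using True by auto
    qed auto
  qed
  show ?thesis unfolding eq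
    using openin_weak_star_integral[OF cont bdd open_greaterThan] by (intro openin_Union) auto
qed

text \<open>Induction over the generation of the topology turns an abstract open set into the usual
  basic neighbourhood, given by finitely many test functions and one tolerance.\<close>

lemma weak_star_neighbourhood:
  fixes \<mu> :: "'a::topological_space measure"
  assumes "openin weak_star_topology T" "\<mu> \<in> T"
  obtains \<Phi> e where "finite \<Phi>" "e > 0"
    "\<And>f. f \<in> \<Phi> \<Longrightarrow> continuous_on UNIV f \<and> bounded (range (f :: 'a \<Rightarrow> real))"
    "\<And>\<nu>. \<nu> \<in> prob_measures \<Longrightarrow> (\<And>f. f \<in> \<Phi> \<Longrightarrow> \<bar>(\<integral>x. f x \<partial>\<nu>) - (\<integral>x. f x \<partial>\<mu>)\<bar> < e) \<Longrightarrow> \<nu> \<in> T"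
proof -
  have "generate_topology_on {{\<mu> \<in> prob_measures. (\<integral>x. f x \<partial>\<mu>) \<in> U} | (f :: 'a \<Rightarrow> real) U.
        continuous_on UNIV f \<and> bounded (range f) \<and> open U} T"
    using assms(1) unfolding weak_star_topology_def by (rule openin_topology_generated_by)
  then have "\<exists>\<Phi> e. finite \<Phi> \<and> e > 0 \<and> (\<forall>f\<in>\<Phi>. continuous_on UNIV f \<and> bounded (range (f :: 'a \<Rightarrow> real))) \<and>
    (\<forall>\<nu>\<in>prob_measures. (\<forall>f\<in>\<Phi>. \<bar>(\<integral>x. f x \<partial>\<nu>) - (\<integral>x. f x \<partial>\<mu>)\<bar> < e) \<longrightarrow> \<nu> \<in> T)"
    using assms(2)
  proof (induction rule: generate_topology_on.induct)
    case (Int A B)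
    then have "\<mu> \<in> A" "\<mu> \<in> B" by auto
    from Int(3)[OF this(1)] obtain \<Phi> :: "('a \<Rightarrow> real) set" and e where *: "finite \<Phi>" "e > 0"
      "\<forall>f\<in>\<Phi>. continuous_on UNIV f \<and> bounded (range f)"
      "\<forall>\<nu>\<in>prob_measures. (\<forall>f\<in>\<Phi>. \<bar>(\<integral>x. f x \<partial>\<nu>) - (\<integral>x. f x \<partial>\<mu>)\<bar> < e) \<longrightarrow> \<nu> \<in> A" by auto
    from Int(4)[OF \<open>\<mu> \<in> B\<close>] obtain \<Psi> :: "('a \<Rightarrow> real) set" and d where "finite \<Psi>" "d > 0"
      "\<forall>f\<in>\<Psi>. continuous_on UNIV f \<and> bounded (range f)"
      "\<forall>\<nu>\<in>prob_measures. (\<forall>f\<in>\<Psi>. \<bar>(\<integral>x. f x \<partial>\<nu>) - (\<integral>x. f x \<partial>\<mu>)\<bar> < d) \<longrightarrow> \<nu> \<in> B" by auto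
    with * show ?case
      by (intro exI[of _ "\<Phi> \<union> \<Psi>"] exI[of _ "min e d"]) auto
  next
    case (UN K)
    then obtain k where k: "k \<in> K" "\<mu> \<in> k" by auto
    from UN(2)[OF this] obtain \<Phi> :: "('a \<Rightarrow> real) set" and e where "finite \<Phi>" "e > 0" "\<forall>f\<in>\<Phi>. continuous_on UNIV f \<and> bounded (range f)"
      "\<forall>\<nu>\<in>prob_measures. (\<forall>f\<in>\<Phi>. \<bar>(\<integral>x. f x \<partial>\<nu>) - (\<integral>x. f x \<partial>\<mu>)\<bar> < e) \<longrightarrow> \<nu> \<in> k" by auto
    then show ?case using k(1) by (intro exI[of _ \<Phi>] exI[of _ e]) auto
  next
    case (Basis s)
    then obtain f :: "'a \<Rightarrow> real" and U where s: "s = {\<mu> \<in> prob_measures. (\<integral>x. f x \<partial>\<mu>) \<in> U}"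
      "continuous_on UNIV f" "bounded (range f)" "open U" by auto
    then obtain e where "e > 0" "\<And>y. \<bar>y - (\<integral>x. f x \<partial>\<mu>)\<bar> < e \<Longrightarrow> y \<in> U"
      using Basis(2) by (auto simp: open_dist dist_real_def)
    then show ?case using s by (intro exI[of _ "{f}"] exI[of _ e]) auto
  qed auto
  then show ?thesis by (elim exE conjE, intro that) auto
qed

section \<open>Dispersed measures\<close>

text \<open>The single inequality says two things: the family carries almost all mass, and, when
  \<open>0 \<in> F\<close> makes its members disjoint, each member has mass below \<open>e\<close>.
  As a lower bound on measures of open sets it is a weak* open condition. An empty family would
  satisfy everything vacuously.\<close>

definition dispersed :: "'a::{topological_space, group_add} set \<Rightarrow> real \<Rightarrow> 'a measure set" where
  "dispersed F e = {\<mu> \<in> prob_measures. \<exists>\<V>. finite \<V> \<and> \<V> \<noteq> {} \<and>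
     (\<forall>V\<in>\<V>. open V \<and> 1 - e < measure \<mu> (\<Union>(\<V> - {V}))) \<and>
     (\<forall>V\<in>\<V>. \<forall>W\<in>\<V>. V \<noteq> W \<longrightarrow> (\<forall>v\<in>V. \<forall>w\<in>W. - v + w \<notin> F))}"

lemma openin_dispersed:
  fixes F :: "'a::{metric_space, group_add} set"
  shows "openin weak_star_topology (dispersed F e)"
proof (subst openin_subopen, intro ballI)
  fix \<mu> assume "\<mu> \<in> dispersed F e"
  then obtain \<V> where \<V>: "finite \<V>" "\<V> \<noteq> {}" "\<forall>V\<in>\<V>. open V \<and> 1 - e < measure \<mu> (\<Union>(\<V> - {V}))"
    "\<forall>V\<in>\<V>. \<forall>W\<in>\<V>. V \<noteq> W \<longrightarrow> (\<forall>v\<in>V. \<forall>w\<in>W. - v + w \<notin> F)" and \<mu>: "\<mu> \<in> prob_measures"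
    unfolding dispersed_def by auto
  define T where "T = (\<Inter>V\<in>\<V>. {\<nu> \<in> prob_measures. 1 - e < measure \<nu> (\<Union>(\<V> - {V}))})"
  have "openin weak_star_topology T"
    unfolding T_def using \<V>(1-3) by (intro openin_INT2 openin_weak_star_measure_open) auto
  moreover have "\<mu> \<in> T" using \<V> \<mu> by (auto simp: T_def)
  moreover have "T \<subseteq> dispersed F e"
  proof
    fix \<nu> assume "\<nu> \<in> T"
    then have "\<nu> \<in> prob_measures" "\<forall>V\<in>\<V>. open V \<and> 1 - e < measure \<nu> (\<Union>(\<V> - {V}))"
      using \<V>(2,3) by (auto simp: T_def)
    then show "\<nu> \<in> dispersed F e"
      unfolding dispersed_def using \<V>(1,2,4) by (intro CollectI conjI exI[of _ \<V>])
  qed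
  ultimately show "\<exists>T. openin weak_star_topology T \<and> \<mu> \<in> T \<and> T \<subseteq> dispersed F e" by blast
qed

text \<open>Borel-Cantelli is applied twice: to the complements of the families, and to the members
  containing a fixed good point \<open>x\<close> of \<open>S\<close>. Almost every \<open>y\<close>
  then lies, for all large \<open>k\<close>, in a member different from that of \<open>x\<close>,
  which is impossible for \<open>y \<in> S\<close>.\<close>

lemma dispersed_measure_eq_0:
  fixes F :: "nat \<Rightarrow> 'a::{topological_space, group_add} set"
  assumes F: "incseq F" "\<And>n. 0 \<in> F n" and \<mu>: "\<And>k. \<mu> \<in> dispersed (F k) ((1/2) ^ k)"
    and S: "S \<in> sets borel" "\<And>x y. x \<in> S \<Longrightarrow> y \<in> S \<Longrightarrow> - x + y \<in> (\<Union>n. F n)"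
  shows "measure \<mu> S = 0"
proof -
  have P: "\<mu> \<in> prob_measures" using \<mu>[of 0] by (simp add: dispersed_def)
  note sets = prob_measuresD(2)[OF P] and space = prob_measuresD(3)[OF P]
  interpret prob_space \<mu> by (rule prob_measuresD(1)[OF P])
  have "\<forall>k. \<exists>\<V>. finite \<V> \<and> \<V> \<noteq> {} \<and>
     (\<forall>V\<in>\<V>. open V \<and> 1 - (1/2) ^ k < measure \<mu> (\<Union>(\<V> - {V}))) \<and>
     (\<forall>V\<in>\<V>. \<forall>W\<in>\<V>. V \<noteq> W \<longrightarrow> (\<forall>v\<in>V. \<forall>w\<in>W. - v + w \<notin> F k))"
    using \<mu> by (simp add: dispersed_def)
  then obtain \<V> where "\<forall>k. finite (\<V> k) \<and> \<V> k \<noteq> {} \<and>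
     (\<forall>V\<in>\<V> k. open V \<and> 1 - (1/2) ^ k < measure \<mu> (\<Union>(\<V> k - {V}))) \<and>
     (\<forall>V\<in>\<V> k. \<forall>W\<in>\<V> k. V \<noteq> W \<longrightarrow> (\<forall>v\<in>V. \<forall>w\<in>W. - v + w \<notin> F k))"
    unfolding choice_iff by (elim exE)
  then have ne: "\<V> k \<noteq> {}" and op: "V \<in> \<V> k \<Longrightarrow> open V"
    and big: "V \<in> \<V> k \<Longrightarrow> 1 - (1/2) ^ k < measure \<mu> (\<Union>(\<V> k - {V}))"
    and sep: "V \<in> \<V> k \<Longrightarrow> W \<in> \<V> k \<Longrightarrow> V \<noteq> W \<Longrightarrow> v \<in> V \<Longrightarrow> w \<in> W \<Longrightarrow> - v + w \<notin> F k" for k V W v w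
    by auto
  have summ: "AE y in \<mu>. \<forall>\<^sub>F k in sequentially. y \<notin> A k"
    if "\<And>k. A k \<in> sets \<mu>" "\<And>k. measure \<mu> (A k) \<le> (1/2) ^ k" for A
  proof -
    have "summable (\<lambda>k. measure \<mu> (A k))"
      using that(2) by (intro summable_comparison_test'[OF summable_geometric[of "1/2 :: real"]]) auto
    from borel_cantelli_AE1[OF that(1) _ this] show ?thesis
      by (simp add: less_top[symmetric] space)
  qed
  define U where "U k = \<Union>(\<V> k)" for k
  have Uset: "U k \<in> sets \<mu>" for k using op by (auto simp: U_def sets intro: borel_open)
  have AE_U: "AE y in \<mu>. \<forall>\<^sub>F k in sequentially. y \<notin> space \<mu> - U k"
  proof (rule summ)
    fix k
    obtain V where V: "V \<in> \<V> k" using ne by auto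
    have "measure \<mu> (\<Union>(\<V> k - {V})) \<le> measure \<mu> (U k)"
      using Uset by (intro finite_measure_mono) (auto simp: U_def)
    then show "measure \<mu> (space \<mu> - U k) \<le> (1/2) ^ k"
      using big[OF V] Uset by (simp add: prob_compl)
  qed (use Uset in auto)
  have "AE y in \<mu>. y \<notin> S"
  \<comment> \<open>If no point of \<open>S\<close> is eventually covered, then \<open>S\<close>
    lies in the exceptional null set of \<open>AE_U\<close>.\<close>
  proof (cases "\<exists>x\<in>S. \<forall>\<^sub>F k in sequentially. x \<in> U k")
    case False
    then show ?thesis using AE_U by (auto simp: space)
  next
    case True
    then obtain x where x: "x \<in> S" "\<forall>\<^sub>F k in sequentially. x \<in> U k" by auto
    \<comment> \<open>Since \<open>0 \<in> F k\<close>, the members are pairwise disjoint, so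
      \<open>A k\<close> is the one member containing \<open>x\<close>, or empty.\<close>
    define A where "A k = \<Union>{V \<in> \<V> k. x \<in> V}" for k
    have "AE y in \<mu>. \<forall>\<^sub>F k in sequentially. y \<notin> A k"
    proof (rule summ)
      fix k
      show "A k \<in> sets \<mu>" using op by (auto simp: A_def sets intro: borel_open)
      show "measure \<mu> (A k) \<le> (1/2) ^ k"
      proof (cases "\<exists>V\<in>\<V> k. x \<in> V")
        case True
        then obtain V where V: "V \<in> \<V> k" "x \<in> V" by auto
        have disj: "v \<notin> W" if "W \<in> \<V> k" "W \<noteq> V" "v \<in> V" for v W
          using sep[OF V(1) that(1) _ that(3), of v] that(2) F(2)[of k] by auto
        then have "A k = V" using V unfolding A_def by blast
        have "\<Union>(\<V> k - {V}) \<in> sets \<mu>" using op by (auto simp: sets intro: borel_open)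
        moreover have "V \<in> sets \<mu>" using op V by (simp add: sets)
        moreover have "V \<inter> \<Union>(\<V> k - {V}) = {}" using disj by blast
        ultimately have "measure \<mu> (V \<union> \<Union>(\<V> k - {V})) = measure \<mu> V + measure \<mu> (\<Union>(\<V> k - {V}))"
          by (intro finite_measure_Union)
        moreover have "measure \<mu> (V \<union> \<Union>(\<V> k - {V})) \<le> 1" by simp
        ultimately show ?thesis using big[OF V(1)] \<open>A k = V\<close> by simp
      next
        case False
        then have "A k = {}" by (auto simp: A_def)
        then show ?thesis by simp
      qed
    qed
    with AE_U show ?thesis
    proof eventually_elim
      case (elim y)
      show "y \<notin> S"
      proof
        assume "y \<in> S"
        then obtain n where n: "- x + y \<in> F n" using S(2) x(1) by blast
        have "\<forall>\<^sub>F k in sequentially. - x + y \<in> F k"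
          using eventually_ge_at_top[of n] by eventually_elim (use n F(1) in \<open>auto dest: incseqD\<close>)
        with elim x(2) have "\<forall>\<^sub>F k in sequentially. False"
        proof eventually_elim
          case (elim k)
          then obtain V W where "V \<in> \<V> k" "x \<in> V" "W \<in> \<V> k" "y \<in> W" by (auto simp: U_def space)
          moreover have "y \<notin> V" using elim calculation by (auto simp: A_def)
          ultimately show ?case using sep[of V k W x y] elim by auto
        qed
        then show False by simp
      qed
    qed
  qed
  then show ?thesis using S(1) by (subst prob_eq_0) (auto simp: sets)
qed

text \<open>A set in the completion has the same measure as its main part, a subset lying in
  \<open>sets M\<close>; for any other set \<open>measure\<close> is \<open>0\<close> by
  default.\<close>

lemma measure_completion_eq_0I:
  assumes "\<And>S. S \<in> sets M \<Longrightarrow> S \<subseteq> B \<Longrightarrow> measure M S = 0"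
  shows "measure (completion M) B = 0"
proof (cases "B \<in> sets (completion M)")
  case True
  have "main_part M B \<subseteq> B" using main_part_null_part_Un[OF True] by blast
  then have "measure M (main_part M B) = 0" using True by (intro assms) auto
  then show ?thesis using True by (simp add: measure_def)
next
  case False
  then show ?thesis by (rule measure_notin_sets)
qed

section \<open>Density of the dispersed measures\<close>

text \<open>The values \<open>f x / e\<close> are rounded down for all \<open>f \<in> \<Phi>\<close>
  at once. Boundedness leaves finitely many cells, and \<open>g\<close> sends each point to a chosen
  representative of its cell.\<close>

lemma finite_valued_approximation:
  fixes \<Phi> :: "('a::topological_space \<Rightarrow> real) set"
  assumes "finite \<Phi>" "\<And>f. f \<in> \<Phi> \<Longrightarrow> continuous_on UNIV f \<and> bounded (range f)" "e > 0"
  shows "\<exists>R g. finite R \<and> g \<in> borel \<rightarrow>\<^sub>M count_space R \<and> (\<forall>x. \<forall>f\<in>\<Phi>. \<bar>f (g x) - f x\<bar> < e)"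
proof -
  define c where "c x = (\<lambda>f\<in>\<Phi>. \<lfloor>f x / e\<rfloor>)" for x
  have "\<forall>f\<in>\<Phi>. \<exists>B. \<forall>x. \<bar>f x\<bar> \<le> B" using assms(2) by (auto simp: bounded_iff)
  then obtain B where B: "\<And>f x. f \<in> \<Phi> \<Longrightarrow> \<bar>f x\<bar> \<le> B f" by metis
  have "range c \<subseteq> PiE \<Phi> (\<lambda>f. {\<lfloor>- B f / e\<rfloor>..\<lfloor>B f / e\<rfloor>})"
  proof safe
    fix x f assume "f \<in> \<Phi>"
    then have "- B f \<le> f x" "f x \<le> B f" using B[of f x] by (auto simp: abs_le_iff)
    then have "- B f / e \<le> f x / e" "f x / e \<le> B f / e"
      using \<open>e > 0\<close> by (auto intro: divide_right_mono simp del: minus_divide_left[symmetric])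
    then show "c x f \<in> {\<lfloor>- B f / e\<rfloor>..\<lfloor>B f / e\<rfloor>}"
      using \<open>f \<in> \<Phi>\<close> by (auto simp: c_def intro: floor_mono)
  qed (auto simp: c_def)
  then have "finite (range c)"
    by (rule finite_subset) (use assms(1) in \<open>auto intro: finite_PiE\<close>)
  define s where "s d = (SOME y. c y = d)" for d
  define g where "g x = s (c x)" for x
  define R where "R = s ` range c"
  have cg: "c (g x) = c x" for x unfolding g_def s_def by (rule someI[of _ x]) simp
  have g_eq_iff: "g x = g z \<longleftrightarrow> c x = c z" for x z
    using cg[of x] cg[of z] by (metis g_def)
  have c_eq_iff: "c x = c z \<longleftrightarrow> (\<forall>f\<in>\<Phi>. \<lfloor>f x / e\<rfloor> = \<lfloor>f z / e\<rfloor>)" for x z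
  proof
    show "c x = c z" if "\<forall>f\<in>\<Phi>. \<lfloor>f x / e\<rfloor> = \<lfloor>f z / e\<rfloor>"
      unfolding c_def by (rule restrict_ext) (use that in blast)
    show "\<forall>f\<in>\<Phi>. \<lfloor>f x / e\<rfloor> = \<lfloor>f z / e\<rfloor>" if "c x = c z"
    proof
      fix f assume "f \<in> \<Phi>"
      then show "\<lfloor>f x / e\<rfloor> = \<lfloor>f z / e\<rfloor>" using fun_cong[OF that, of f] by (simp add: c_def)
    qed
  qed
  have "g \<in> borel \<rightarrow>\<^sub>M count_space R"
  proof (subst measurable_count_space_eq_countable)
    show "countable R" using \<open>finite (range c)\<close> by (auto simp: R_def intro: countable_finite)
    have "g -` {p} \<inter> space borel \<in> sets borel" if p: "p \<in> R" for p
    proof -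
      obtain z where "p = g z" using p by (auto simp: R_def g_def)
      then have "g -` {p} \<inter> space borel = {x \<in> space borel. \<forall>f\<in>\<Phi>. \<lfloor>f x / e\<rfloor> = \<lfloor>f z / e\<rfloor>}"
        by (auto simp: g_eq_iff c_eq_iff)
      also have "\<dots> \<in> sets borel"
      proof (rule sets.sets_Collect_finite_All[OF _ assms(1)])
        fix f assume "f \<in> \<Phi>"
        then have [measurable]: "f \<in> borel_measurable borel"
          using assms(2) by (intro borel_measurable_continuous_onI) auto
        show "{x \<in> space borel. \<lfloor>f x / e\<rfloor> = \<lfloor>f z / e\<rfloor>} \<in> sets borel" by measurable
      qed
      finally show ?thesis .
    qed
    then show "g \<in> space borel \<rightarrow> R \<and> (\<forall>a\<in>R. g -` {a} \<inter> space borel \<in> sets borel)"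
      by (auto simp: R_def g_def)
  qed
  moreover have "\<bar>f (g x) - f x\<bar> < e" if "f \<in> \<Phi>" for f x
  proof -
    have "\<lfloor>f (g x) / e\<rfloor> = \<lfloor>f x / e\<rfloor>"
      using cg[of x] that by (simp add: c_eq_iff)
    then have "\<bar>f (g x) / e - f x / e\<bar> < 1" by linarith
    then have "\<bar>(f (g x) - f x) / e\<bar> < 1" by (simp add: diff_divide_distrib)
    then show ?thesis using \<open>e > 0\<close> by (simp add: abs_divide)
  qed
  ultimately show ?thesis using \<open>finite (range c)\<close> by (intro exI[of _ R] exI[of _ g]) (auto simp: R_def)
qed

text \<open>The measure sought is the law of \<open>q (g x, n)\<close> with \<open>x\<close>
  distributed by \<open>\<mu>\<close> and \<open>n\<close> uniform on \<open>{..<N}\<close>: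
  \<open>g\<close> makes the support finite, the \<open>N\<close> copies split each atom into small
  ones, and \<open>q\<close> puts the copies in general position while hardly changing the test
  integrals.\<close>

lemma dispersed_meets_open:
  fixes F :: "'a::{metric_space, topological_group_add} set"
  assumes F: "closed F" "interior F = {}" "0 \<in> F" and e: "e > 0"
    and T: "openin weak_star_topology T" "T \<noteq> {}"
  shows "dispersed F e \<inter> T \<noteq> {}"
proof -
  obtain \<mu> where "\<mu> \<in> T" using T(2) by auto
  then have \<mu>: "\<mu> \<in> prob_measures" using openin_subset[OF T(1)] by auto
  obtain \<Phi> :: "('a \<Rightarrow> real) set" and c where \<Phi>: "finite \<Phi>" "c > 0"
    "\<And>f. f \<in> \<Phi> \<Longrightarrow> continuous_on UNIV f \<and> bounded (range f)"
    and nbh: "\<And>\<nu>. \<nu> \<in> prob_measures \<Longrightarrow> (\<And>f. f \<in> \<Phi> \<Longrightarrow> \<bar>(\<integral>x. f x \<partial>\<nu>) - (\<integral>x. f x \<partial>\<mu>)\<bar> < c) \<Longrightarrow> \<nu> \<in> T"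
    using weak_star_neighbourhood[OF T(1) \<open>\<mu> \<in> T\<close>] by blast
  \<comment> \<open>Rounding by \<open>g\<close> and moving to \<open>q\<close> each cost less than
    \<open>d\<close>, and \<open>2 * d < c\<close>.\<close>
  define d where "d = c / 3"
  have "d > 0" using \<Phi>(2) by (simp add: d_def)
  obtain R g where R: "finite R" and g: "g \<in> borel \<rightarrow>\<^sub>M count_space R"
    and fg: "\<And>x f. f \<in> \<Phi> \<Longrightarrow> \<bar>f (g x) - f x\<bar> < d"
    using finite_valued_approximation[OF \<Phi>(1,3) \<open>d > 0\<close>] by auto
  have gR: "g x \<in> R" for x using measurable_space[OF g] by simp
  obtain N :: nat where N: "1 / e < real N" using reals_Archimedean2 by blast
  then have "N > 0" using e by (cases "N = 0") (auto simp: field_simps)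
  define I where "I = R \<times> {..<N}"
  define U where "U i = {y. \<forall>f\<in>\<Phi>. \<bar>f y - f (fst i)\<bar> < d}" for i :: "'a \<times> nat"
  have "finite I" "I \<noteq> {}" using R gR \<open>N > 0\<close> by (auto simp: I_def)
  have U: "open (U i) \<and> U i \<noteq> {}" for i
  proof
    have "U i = (\<Inter>f\<in>\<Phi>. {y. \<bar>f y - f (fst i)\<bar> < d})" by (auto simp: U_def)
    also have "open \<dots>" using \<Phi>(1,3) by (intro open_INT ballI open_Collect_less continuous_intros) auto
    finally show "open (U i)" .
    have "fst i \<in> U i" using \<open>d > 0\<close> by (auto simp: U_def)
    then show "U i \<noteq> {}" by auto
  qed
  obtain q r where r: "0 < r" and qU: "\<And>i. i \<in> I \<Longrightarrow> cball (q i) r \<subseteq> U i"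
    and sep: "\<And>i j v w. i \<in> I \<Longrightarrow> j \<in> I \<Longrightarrow> i \<noteq> j \<Longrightarrow> v \<in> cball (q i) r \<Longrightarrow> w \<in> cball (q j) r \<Longrightarrow> - v + w \<notin> F"
    by (rule exists_cballs_differences_avoid[where U = U, OF \<open>finite I\<close> F(1,2) U zero_less_one]) (rule that)
  define M2 where "M2 = uniform_count_measure {..<N}"
  have "prob_space M2" unfolding M2_def
    using \<open>N > 0\<close> by (intro prob_space_uniform_count_measure) auto
  interpret M1: prob_space \<mu> by (rule prob_measuresD(1)[OF \<mu>])
  interpret M2: prob_space M2 by fact
  interpret P: pair_prob_space \<mu> M2 ..
  let ?P = "\<mu> \<Otimes>\<^sub>M M2"
  define h where "h z = q (g (fst z), snd z)" for z :: "'a \<times> nat"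
  have spP: "space ?P = UNIV \<times> {..<N}"
    by (simp add: space_pair_measure prob_measuresD(3)[OF \<mu>] M2_def space_uniform_count_measure)
  have h: "h \<in> ?P \<rightarrow>\<^sub>M borel"
    unfolding h_def
  proof (rule measurable_compose_countable'[where I = R and g = "\<lambda>z. g (fst z)"])
    have "g \<in> \<mu> \<rightarrow>\<^sub>M count_space R"
      using g measurable_cong_sets[OF prob_measuresD(2)[OF \<mu>] refl] by blast
    then show "(\<lambda>z. g (fst z)) \<in> ?P \<rightarrow>\<^sub>M count_space R"
      by (rule measurable_compose[OF measurable_fst])
    have "(\<lambda>n. q (p, n)) \<in> M2 \<rightarrow>\<^sub>M borel" for p
      by (simp add: M2_def measurable_def sets_uniform_count_measure space_uniform_count_measure)
    then show "(\<lambda>z. q (p, snd z)) \<in> ?P \<rightarrow>\<^sub>M borel" for p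
      by (rule measurable_compose[OF measurable_snd])
  qed (use R in \<open>simp add: countable_finite\<close>)
  define \<nu> where "\<nu> = distr ?P borel h"
  have \<nu>: "\<nu> \<in> prob_measures"
    unfolding prob_measures_def \<nu>_def using P.prob_space_distr[OF h] by simp
  have "\<nu> \<in> T"
  proof (rule nbh[OF \<nu>])
    fix f assume f: "f \<in> \<Phi>"
    have fm: "f \<in> borel_measurable borel"
      using \<Phi>(3)[OF f] by (intro borel_measurable_continuous_onI) auto
    have fm': "f \<in> borel_measurable \<mu>"
      using fm measurable_cong_sets[OF prob_measuresD(2)[OF \<mu>] refl] by blast
    have \<mu>P: "distr ?P \<mu> fst = \<mu>" by (rule M2.distr_pair_fst)
    have "integrable \<nu> f" "integrable \<mu> f"
      using integrable_bounded_continuous \<Phi>(3)[OF f] \<nu> \<mu> by auto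
    then have int: "integrable ?P (\<lambda>z. f (h z))" "integrable ?P (\<lambda>z. f (fst z))"
      using integrable_distr_eq[OF h fm] integrable_distr_eq[OF measurable_fst[of \<mu> M2] fm'] \<mu>P
      unfolding \<nu>_def by auto
    have "(\<integral>x. f x \<partial>\<nu>) = (\<integral>z. f (h z) \<partial>?P)"
      unfolding \<nu>_def by (rule integral_distr[OF h fm])
    moreover have "(\<integral>x. f x \<partial>\<mu>) = (\<integral>z. f (fst z) \<partial>?P)"
      using integral_distr[OF measurable_fst[of \<mu> M2] fm'] \<mu>P by simp
    ultimately have eq: "(\<integral>x. f x \<partial>\<nu>) - (\<integral>x. f x \<partial>\<mu>) = (\<integral>z. f (h z) - f (fst z) \<partial>?P)"
      using int by simp
    have bd: "- (2 * d) \<le> f (h z) - f (fst z) \<and> f (h z) - f (fst z) \<le> 2 * d" if "z \<in> space ?P" for z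
    proof -
      have "(g (fst z), snd z) \<in> I" using that gR spP by (auto simp: I_def)
      moreover have "h z \<in> cball (q (g (fst z), snd z)) r" using r by (simp add: h_def)
      ultimately have "h z \<in> U (g (fst z), snd z)" using qU by blast
      then have "\<bar>f (h z) - f (g (fst z))\<bar> < d" using f by (simp add: U_def)
      with fg[OF f, of "fst z"] show ?thesis by linarith
    qed
    have "(\<integral>z. f (h z) - f (fst z) \<partial>?P) \<le> 2 * d"
      using int bd by (intro P.integral_le_const AE_I2 Bochner_Integration.integrable_diff) blast+
    moreover have "- (2 * d) \<le> (\<integral>z. f (h z) - f (fst z) \<partial>?P)"
      using int bd by (intro P.integral_ge_const AE_I2 Bochner_Integration.integrable_diff) blast+
    ultimately show "\<bar>(\<integral>x. f x \<partial>\<nu>) - (\<integral>x. f x \<partial>\<mu>)\<bar> < c"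
      unfolding eq using \<Phi>(2) by (simp add: d_def abs_le_iff)
  qed
  moreover have "\<nu> \<in> dispersed F e"
  proof -
    interpret \<nu>: prob_space \<nu> by (rule prob_measuresD(1)[OF \<nu>])
    define \<V> where "\<V> = (\<lambda>i. ball (q i) r) ` I"
    have "1 - e < measure \<nu> (\<Union>(\<V> - {V}))" if V: "V \<in> \<V>" for V
    proof -
      obtain p j where a: "(p, j) \<in> I" "V = ball (q (p, j)) r" using V by (auto simp: \<V>_def)
      define B where "B = \<Union>(\<V> - {V})"
      have B: "B \<in> sets borel" unfolding B_def \<V>_def by (intro borel_open open_Union) auto
      \<comment> \<open>Values outside \<open>B\<close> lie in the omitted ball \<open>V\<close>. As
        \<open>0 \<in> F\<close>, balls with different indices are disjoint, so the second index
        must be \<open>j\<close>, an event of probability \<open>1 / N\<close>.\<close>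
      have sub: "h -` (- B) \<inter> space ?P \<subseteq> UNIV \<times> {j}"
      proof
        fix z assume z: "z \<in> h -` (- B) \<inter> space ?P"
        let ?b = "(g (fst z), snd z)"
        have b: "?b \<in> I" using z gR spP by (auto simp: I_def)
        have hb: "h z \<in> ball (q ?b) r" using r by (simp add: h_def)
        have "ball (q ?b) r = V"
          using z hb b unfolding B_def \<V>_def by blast
        then have "h z \<in> cball (q (p, j)) r" "h z \<in> cball (q ?b) r"
          using hb a(2) ball_subset_cball by blast+
        then have "?b = (p, j)" using sep[OF b a(1), of "h z" "h z"] F(3) by auto
        then show "z \<in> UNIV \<times> {j}" by (auto simp: mem_Times_iff)
      qed
      have j: "j < N" using a by (simp add: I_def)
      have "{j} \<in> sets M2" using j by (simp add: M2_def sets_uniform_count_measure)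
      have "UNIV \<in> sets \<mu>" using sets.top[of \<mu>] prob_measuresD(3)[OF \<mu>] by simp
      have "measure \<nu> (- B) = measure ?P (h -` (- B) \<inter> space ?P)"
        unfolding \<nu>_def using B by (intro measure_distr h) auto
      also have "\<dots> \<le> measure ?P (UNIV \<times> {j})"
        using sub \<open>{j} \<in> sets M2\<close> \<open>UNIV \<in> sets \<mu>\<close> by (intro P.finite_measure_mono) auto
      also have "\<dots> = 1 / N"
      proof -
        have "emeasure ?P (UNIV \<times> {j}) = emeasure \<mu> UNIV * emeasure M2 {j}"
          using \<open>{j} \<in> sets M2\<close> \<open>UNIV \<in> sets \<mu>\<close> by (intro M2.emeasure_pair_measure_Times)
        also have "emeasure \<mu> UNIV = 1" using M1.emeasure_space_1 prob_measuresD(3)[OF \<mu>] by simp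
        also have "emeasure M2 {j} = ennreal (1 / N)"
          using j by (simp add: M2_def emeasure_uniform_count_measure)
        finally show ?thesis by (simp add: measure_def)
      qed
      also have "\<dots> < e" using N e \<open>N > 0\<close> by (simp add: field_simps)
      finally have "measure \<nu> (- B) < e" .
      moreover have "measure \<nu> (- B) = 1 - measure \<nu> B"
        using \<nu>.prob_compl[of B] B prob_measuresD(2,3)[OF \<nu>] by (simp add: Compl_eq_Diff_UNIV)
      ultimately show ?thesis by (simp add: B_def)
    qed
    moreover have "- v + w \<notin> F" if "V \<in> \<V>" "W \<in> \<V>" "V \<noteq> W" "v \<in> V" "w \<in> W" for V W v w
      using that sep unfolding \<V>_def by fastforce
    moreover have "finite \<V>" "\<V> \<noteq> {}" "\<forall>V\<in>\<V>. open V"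
      using \<open>finite I\<close> \<open>I \<noteq> {}\<close> by (auto simp: \<V>_def)
    ultimately show ?thesis unfolding dispersed_def using \<nu> by (intro CollectI conjI exI[of _ \<V>] ballI impI) auto
  qed
  ultimately show ?thesis by blast
qed

section \<open>Comeagerness of \<open>T_l A\<close>\<close>

lemma inv_prod_translate:
  fixes g :: "'a::group_add"
  assumes "x \<in> (\<lambda>a. g + a) ` A" "y \<in> (\<lambda>a. g + a) ` A"
  shows "- x + y \<in> inv_prod A"
proof -
  obtain a b where "a \<in> A" "b \<in> A" "x = g + a" "y = g + b" using assms by auto
  moreover have "- (g + a) + (g + b) = - a + b"
    by (simp add: minus_add add.assoc) (simp add: add.assoc[symmetric])
  ultimately show ?thesis unfolding inv_prod_def by blast
qed

text \<open>Each \<open>W k\<close> is open and dense, so its complement is nowhere dense. A measure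
  in every \<open>W k\<close> vanishes on all measurable subsets of translates of \<open>A\<close>,
  hence these countably many complements cover the complement of \<open>T_l A\<close>.\<close>

lemma comeager_T_l:
  fixes A :: "'a::{polish_space, topological_group_add} set"
  assumes "uncountable (UNIV :: 'a set)" "meager_in euclidean (inv_prod A)"
  shows "comeager_in weak_star_topology (T_l A)"
proof -
  obtain F :: "nat \<Rightarrow> 'a set" where F: "incseq F" "\<And>n. closed (F n)" "\<And>n. interior (F n) = {}"
    "\<And>n. 0 \<in> F n" "inv_prod A \<subseteq> (\<Union>n. F n)"
    using meager_exhaustion[OF assms(2) not_open_singleton_zero[OF assms(1)]] by metis
  define W where "W k = dispersed (F k) ((1/2)^k)" for k
  have "nowhere_dense_in weak_star_topology (prob_measures - W k)" for k
  proof -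
    have op: "openin weak_star_topology (W k)" unfolding W_def by (rule openin_dispersed)
    then have "closedin weak_star_topology (prob_measures - W k)"
      using closedin_diff[OF closedin_topspace op] by simp
    moreover have "weak_star_topology closure_of W k = topspace weak_star_topology"
      unfolding dense_intersects_open W_def using dispersed_meets_open[OF F(2,3,4)] by simp
    then have "weak_star_topology interior_of (topspace weak_star_topology - W k) = {}"
      by (simp only: interior_of_complement Diff_cancel)
    ultimately show ?thesis by (simp add: nowhere_dense_in_def closure_of_closedin)
  qed
  moreover have "\<mu> \<in> T_l A" if "\<mu> \<in> prob_measures" "\<And>k. \<mu> \<in> W k" for \<mu>
    unfolding T_l_def
  proof (intro CollectI conjI allI measure_completion_eq_0I)
    fix g S assume S: "S \<in> sets \<mu>" "S \<subseteq> (\<lambda>a. g + a) ` A"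
    show "measure \<mu> S = 0"
    proof (rule dispersed_measure_eq_0[OF F(1,4)])
      show "\<mu> \<in> dispersed (F k) ((1/2)^k)" for k using that(2)[of k] by (simp add: W_def)
      show "S \<in> sets borel" using S(1) prob_measuresD(2)[OF that(1)] by simp
      show "- x + y \<in> (\<Union>n. F n)" if "x \<in> S" "y \<in> S" for x y
        using inv_prod_translate[of x g A y] that S(2) F(5) by blast
    qed
  qed fact
  then have "prob_measures - T_l A \<subseteq> \<Union>(range (\<lambda>k. prob_measures - W k))" by blast
  ultimately show ?thesis
    unfolding comeager_in_def meager_in_def
    by (intro conjI exI[of _ "range (\<lambda>k. prob_measures - W k)"]) (auto simp: T_l_def)
qed

section \<open>A measure vanishing on all translates\<close>

text \<open>Stage \<open>k\<close> has \<open>2 ^ k\<close> closed balls with quotients avoiding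
  \<open>F k\<close>, and ball \<open>j\<close> of the next stage lies in ball
  \<open>j div 2\<close>. The binary digits of \<open>t\<close> select a nested sequence, which by
  completeness shrinks to the point \<open>T t\<close>.\<close>

lemma Cantor_scheme:
  fixes F :: "nat \<Rightarrow> 'a::{polish_space, topological_group_add} set"
  assumes "\<And>n. closed (F n)" "\<And>n. interior (F n) = {}"
  obtains T :: "real \<Rightarrow> 'a" where "T \<in> borel_measurable borel"
    "\<And>k t u. t \<in> {0..<1} \<Longrightarrow> u \<in> {0..<1} \<Longrightarrow> \<lfloor>2 ^ k * t\<rfloor> \<noteq> \<lfloor>2 ^ k * u\<rfloor> \<Longrightarrow> - T t + T u \<notin> F k"
proof -
  \<comment> \<open>A stage \<open>s\<close> is a pair: \<open>fst s\<close> lists the centres and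
    \<open>snd s\<close> is their common radius.\<close>
  define P where "P k s \<longleftrightarrow> (0 < snd s \<and> snd s < (1/2) ^ k \<and>
      (\<forall>i<2^k. \<forall>j<2^k. i \<noteq> j \<longrightarrow>
        (\<forall>v\<in>cball (fst s i) (snd s). \<forall>w\<in>cball (fst s j) (snd s). - v + w \<notin> F k)))"
    for k and s :: "(nat \<Rightarrow> 'a) \<times> real"
  define Q where "Q k s s' \<longleftrightarrow> (\<forall>j<2^Suc k. cball (fst s' j) (snd s') \<subseteq> cball (fst s (j div 2)) (snd s))"
    for k and s s' :: "(nat \<Rightarrow> 'a) \<times> real"
  have step: "\<exists>s. P k s \<and> (\<forall>j<2^k. cball (fst s j) (snd s) \<subseteq> U j)"
    if U: "\<And>j. j < 2^k \<Longrightarrow> open (U j) \<and> U j \<noteq> {}" for k U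
  proof -
    obtain q r where "0 < r" "r < (1/2)^k" "\<And>i. i \<in> {..<2^k} \<Longrightarrow> cball (q i) r \<subseteq> U i"
      "\<And>i j v w. i \<in> {..<2^k} \<Longrightarrow> j \<in> {..<2^k} \<Longrightarrow> i \<noteq> j \<Longrightarrow> v \<in> cball (q i) r \<Longrightarrow> w \<in> cball (q j) r \<Longrightarrow> - v + w \<notin> F k"
    proof (rule exists_cballs_differences_avoid[where I = "{..<2^k}" and U = U and F = "F k" and d = "(1/2)^k"])
    qed (use assms U in auto)
    then show ?thesis by (intro exI[of _ "(q, r)"]) (auto simp: P_def)
  qed
  have "\<exists>s. \<forall>k. P k (s k) \<and> Q k (s k) (s (Suc k))"
  proof (rule dependent_nat_choice)
    show "\<exists>s. P 0 s" using step[of 0 "\<lambda>_. UNIV"] by auto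
    show "\<exists>s'. P (Suc k) s' \<and> Q k s s'" if s: "P k s" for s k
    proof -
      have "open (ball (fst s (j div 2)) (snd s)) \<and> ball (fst s (j div 2)) (snd s) \<noteq> {}" for j
        using s by (simp add: P_def)
      from step[where k = "Suc k" and U = "\<lambda>j. ball (fst s (j div 2)) (snd s)", OF this] obtain s' where s': "P (Suc k) s'"
        "\<forall>j<2 ^ Suc k. cball (fst s' j) (snd s') \<subseteq> ball (fst s (j div 2)) (snd s)" by blast
      then have "Q k s s'" unfolding Q_def using ball_subset_cball by (metis order_trans)
      with s' show ?thesis by blast
    qed
  qed
  then obtain s where s: "\<And>k. P k (s k)" "\<And>k. Q k (s k) (s (Suc k))" by blast
  define x where "x k = fst (s k)" for k
  define r where "r k = snd (s k)" for k
  have r: "0 < r k" "r k < (1/2)^k" for k using s(1)[of k] by (auto simp: P_def r_def)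
  have sep: "- v + w \<notin> F k"
    if "i < 2^k" "j < 2^k" "i \<noteq> j" "v \<in> cball (x k i) (r k)" "w \<in> cball (x k j) (r k)" for i j k v w
    using s(1)[of k] that by (auto simp: P_def x_def r_def)
  have nest: "cball (x (Suc k) j) (r (Suc k)) \<subseteq> cball (x k (j div 2)) (r k)" if "j < 2^Suc k" for j k
    using s(2)[of k] that unfolding Q_def x_def r_def by blast
  \<comment> \<open>This is the number formed by the first \<open>k\<close> binary digits of
    \<open>t\<close>. Using \<open>frac\<close> makes it a valid index for every real
    \<open>t\<close>, so \<open>T\<close> is defined on the whole line.\<close>
  define n where "n k t = nat \<lfloor>2 ^ k * frac t\<rfloor>" for k :: nat and t :: real
  have n_less: "n k t < 2 ^ k" for k t
  proof -
    have "2 ^ k * frac t < 2 ^ k * 1" by (intro mult_strict_left_mono) (auto simp: frac_lt_1)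
    then have "\<lfloor>2 ^ k * frac t\<rfloor> < 2 ^ k" by (simp add: floor_less_iff)
    then show ?thesis by (simp add: n_def nat_less_iff)
  qed
  have n_Suc: "n (Suc k) t div 2 = n k t" for k t
  proof -
    have "\<lfloor>2 ^ k * frac t\<rfloor> = \<lfloor>2 ^ Suc k * frac t / real_of_int 2\<rfloor>" by simp
    also have "\<dots> = \<lfloor>2 ^ Suc k * frac t\<rfloor> div 2" by (rule floor_divide_real_eq_div) simp
    finally show ?thesis by (simp add: n_def nat_div_distrib)
  qed
  define C where "C t k = cball (x k (n k t)) (r k)" for t k
  have "C t (Suc k) \<subseteq> C t k" for t k
    unfolding C_def using nest[OF n_less[of "Suc k" t]] by (simp add: n_Suc)
  then have decr: "k \<le> m \<Longrightarrow> C t m \<subseteq> C t k" for t k m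
    by (rule lift_Suc_antimono_le)
  have "\<exists>a. \<Inter>(range (C t)) = {a}" for t
  proof (rule decreasing_closed_nest_sing)
    fix e :: real assume "e > 0"
    then obtain k where "(1/2 :: real)^k < e / 2"
      using real_arch_pow_inv[of "e/2" "1/2"] by auto
    then have "dist a b < e" if "a \<in> C t k" "b \<in> C t k" for a b
      using that r(2)[of k] dist_triangle3[of a b "x k (n k t)"] by (auto simp: C_def)
    then show "\<exists>k. \<forall>a\<in>C t k. \<forall>b\<in>C t k. dist a b < e" by blast
  next
    show "C t m \<noteq> {}" for m using r(1)[of m] by (simp add: C_def)
  qed (use decr in \<open>auto simp: C_def\<close>)
  then obtain T where T: "\<And>t. \<Inter>(range (C t)) = {T t}" by metis
  have TC: "T t \<in> C t k" for t k using T[of t] by blast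
  \<comment> \<open>The map \<open>T\<close> is the pointwise limit of the ball centres, which
    depend on \<open>t\<close> only through the integer \<open>n k t\<close>.\<close>
  have meas: "T \<in> borel_measurable borel"
  proof (rule borel_measurable_LIMSEQ_metric)
    have [measurable]: "n k \<in> borel \<rightarrow>\<^sub>M count_space UNIV" for k
      unfolding n_def frac_def by measurable
    show "(\<lambda>t. x k (n k t)) \<in> borel_measurable borel" for k
      by (rule measurable_compose[of "n k" _ "count_space UNIV"]) auto
    show "(\<lambda>k. x k (n k t)) \<longlonglongrightarrow> T t" for t
    proof -
      have "norm (dist (x k (n k t)) (T t)) \<le> (1/2)^k" for k
        using TC[of t k] r(2)[of k] by (simp add: C_def)
      then have "(\<lambda>k. dist (x k (n k t)) (T t)) \<longlonglongrightarrow> 0"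
        by (intro Lim_null_comparison[OF always_eventually LIMSEQ_power_zero[of "1/2"]]) auto
      then show ?thesis by (simp add: tendsto_dist_iff[of _ "T t"])
    qed
  qed
  show ?thesis
  proof (rule that[OF meas])
    fix k and t u :: real
    assume tu: "t \<in> {0..<1}" "u \<in> {0..<1}" and ne: "\<lfloor>2 ^ k * t\<rfloor> \<noteq> \<lfloor>2 ^ k * u\<rfloor>"
    then have "frac t = t" "frac u = u" by (auto simp: frac_eq)
    then have "n k t \<noteq> n k u" using tu ne by (auto simp: n_def nat_eq_iff)
    then show "- T t + T u \<notin> F k"
      using sep[OF n_less n_less] TC unfolding C_def by blast
  qed
qed

text \<open>Distinct points of \<open>[0,1)\<close> have different indices at all late stages, so
  the quotient of their images avoids every \<open>F k\<close> and thus \<open>inv_prod A\<close>.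
  Each translate of \<open>A\<close> therefore has at most one preimage there, and the image of
  Lebesgue measure vanishes on it.\<close>

lemma T_l_nonempty:
  fixes A :: "'a::{polish_space, topological_group_add} set"
  assumes "uncountable (UNIV :: 'a set)" "meager_in euclidean (inv_prod A)"
  shows "T_l A \<noteq> {}"
proof -
  obtain F :: "nat \<Rightarrow> 'a set" where F: "incseq F" "\<And>n. closed (F n)" "\<And>n. interior (F n) = {}"
    "\<And>n. 0 \<in> F n" "inv_prod A \<subseteq> (\<Union>n. F n)"
    using meager_exhaustion[OF assms(2) not_open_singleton_zero[OF assms(1)]] by metis
  obtain T :: "real \<Rightarrow> 'a" where T: "T \<in> borel_measurable borel"
    and sep: "\<And>k t u. t \<in> {0..<1} \<Longrightarrow> u \<in> {0..<1} \<Longrightarrow> \<lfloor>2 ^ k * t\<rfloor> \<noteq> \<lfloor>2 ^ k * u\<rfloor> \<Longrightarrow> - T t + T u \<notin> F k"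
    by (rule Cantor_scheme[where F = F, OF F(2,3)]) (rule that)
  have avoid: "- T t + T u \<notin> inv_prod A" if tu: "t \<in> {0..<1}" "u \<in> {0..<1}" "t \<noteq> u" for t u
  proof
    assume "- T t + T u \<in> inv_prod A"
    then obtain m where m: "- T t + T u \<in> F m" using F(5) by blast
    obtain l where l: "1 / \<bar>t - u\<bar> < 2 ^ l" using real_arch_pow[of 2 "1 / \<bar>t - u\<bar>"] by auto
    \<comment> \<open>The bound \<open>l\<close> makes the scaled points more than \<open>1\<close>
      apart, so their floors differ; the bound \<open>m\<close> keeps the quotient in
      \<open>F k\<close> by monotonicity.\<close>
    define k where "k = max l m"
    have "(2::real) ^ l \<le> 2 ^ k" by (simp add: k_def)
    then have "1 / \<bar>t - u\<bar> < 2 ^ k" using l by linarith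
    then have "1 < 2 ^ k * \<bar>t - u\<bar>" using tu(3) by (simp add: field_simps)
    then have "1 < \<bar>2 ^ k * t - 2 ^ k * u\<bar>"
      by (simp add: right_diff_distrib[symmetric] abs_mult)
    then have "\<lfloor>2 ^ k * t\<rfloor> \<noteq> \<lfloor>2 ^ k * u\<rfloor>" by linarith
    moreover have "- T t + T u \<in> F k" using m incseqD[OF F(1), of m k] by (auto simp: k_def)
    ultimately show False using sep tu by blast
  qed
  define M where "M = uniform_measure lborel {0..<1 :: real}"
  define \<mu> where "\<mu> = distr M borel T"
  interpret M: prob_space M unfolding M_def by (intro prob_space_uniform_measure) auto
  have TM: "T \<in> M \<rightarrow>\<^sub>M borel" using T by (simp add: M_def)
  have \<mu>: "\<mu> \<in> prob_measures"
    unfolding prob_measures_def \<mu>_def using M.prob_space_distr[OF TM] by simp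
  have "\<mu> \<in> T_l A"
    unfolding T_l_def
  proof (intro CollectI conjI allI measure_completion_eq_0I)
    fix g S assume S: "S \<in> sets \<mu>" "S \<subseteq> (\<lambda>a. g + a) ` A"
    then have Sb: "S \<in> sets borel" by (simp add: \<mu>_def)
    define B where "B = {0..<1} \<inter> T -` S"
    have "t = u" if "t \<in> B" "u \<in> B" for t u
      using avoid[of t u] inv_prod_translate[of "T t" g A "T u"] that S(2) by (auto simp: B_def)
    then have "\<exists>t. B \<subseteq> {t}" by blast
    then have "countable B" by (meson countable_subset countable_insert countable_empty)
    have "emeasure \<mu> S = emeasure M (T -` S)"
      unfolding \<mu>_def using emeasure_distr[OF TM Sb] by (simp add: M_def)
    also have "\<dots> = emeasure lborel B / emeasure lborel {0..<1::real}"
      unfolding M_def B_def using measurable_sets[OF T Sb] by (intro emeasure_uniform_measure) auto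
    also have "emeasure lborel B = 0" using \<open>countable B\<close> by (rule emeasure_lborel_countable)
    finally show "measure \<mu> S = 0" by (simp add: measure_def)
  qed fact
  then show ?thesis by blast
qed

theorem theoremA:
  assumes "uncountable (UNIV :: ('a::{polish_space, topological_group_add}) set)"
  shows "(\<forall>A :: 'a set. universally_measurable A \<and> meager_in euclidean (inv_prod A)
            \<longrightarrow> comeager_in weak_star_topology (T_l A))
       \<and> (\<forall>A :: 'a set. analytic A \<and> \<not> generically_left_Haar_null A
            \<longrightarrow> \<not> meager_in euclidean (inv_prod A))
       \<and> (\<forall>A :: 'a set. analytic A \<and> \<not> left_Haar_null A
            \<longrightarrow> \<not> meager_in euclidean (inv_prod A))"
proof (intro conjI allI impI)
  fix A :: "'a set"
  show "comeager_in weak_star_topology (T_l A)"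
    if "universally_measurable A \<and> meager_in euclidean (inv_prod A)"
    using comeager_T_l[OF assms] that by blast
  show "\<not> meager_in euclidean (inv_prod A)" if "analytic A \<and> \<not> generically_left_Haar_null A"
    using comeager_T_l[OF assms] analytic_imp_universally_measurable that
    unfolding generically_left_Haar_null_def by blast
  show "\<not> meager_in euclidean (inv_prod A)" if "analytic A \<and> \<not> left_Haar_null A"
    using T_l_nonempty[OF assms, of A] analytic_imp_universally_measurable that
    unfolding left_Haar_null_def T_l_def by blast
qed

end
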